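(* Let $a$ and $b$ be positive integers with $b\geq\max\{a,3\}$, and let $G$ be a graph of order $n$ with $n\geq\max\{a+2,7\}$. If $$\rho(G)>\rho(K_a\vee(K_{n-a-1}\cup K_1)),$$ then $G$ is a fractional $[a,b]$-deleted graph.
   Context: All graphs are finite, undirected, without loops or multiple edges. $\rho(G)$ denotes the spectral radius (largest eigenvalue of the adjacency matrix) of $G$. $K_m$ is the complete graph on $m$ vertices, $G_1\cup G_2$ is the disjoint union, and $G_1\vee G_2$ is the join (disjoint union plus all edges between a vertex of $G_1$ and a vertex of $G_2$). For a vertex $v$, $E_G(v)$ denotes the set of edges incident with $v$. For positive integers $a\leq b$, a fractional $[a,b]$-factor of $G$ is given by a function $h:E(G)\to[0,1]$ such that $a\leq\sum_{e\in E_G(v)}h(e)\leq b$ for every $v\in V(G)$. $G$ is called a fractional $[a,b]$-deleted graph if for every edge $e\in E(G)$, the graph $G-e$ has a fractional $[a,b]$-factor. *)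

theory Defs
  imports "Jordan_Normal_Form.Spectral_Radius"
begin

text \<open>An edge is a two-element set of vertices; this excludes loops and multiple edges and makes
  edges undirected.\<close>

record 'v sgraph =
  verts :: "'v set"
  edges :: "'v set set"

definition simple_graph :: "'v sgraph \<Rightarrow> bool" where
  "simple_graph G \<longleftrightarrow> finite (verts G) \<and> (\<forall>e\<in>edges G. e \<subseteq> verts G \<and> card e = 2)"

definition graph_order :: "'v sgraph \<Rightarrow> nat" where
  "graph_order G = card (verts G)"

definition complete_graph :: "nat \<Rightarrow> nat sgraph" where
  "complete_graph m = \<lparr>verts = {..<m}, edges = {e. e \<subseteq> {..<m} \<and> card e = 2}\<rparr>"

definition graph_union :: "'u sgraph \<Rightarrow> 'v sgraph \<Rightarrow> ('u + 'v) sgraph" where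
  "graph_union G H =
     \<lparr>verts = verts G <+> verts H,
      edges = (\<lambda>e. Inl ` e) ` edges G \<union> (\<lambda>e. Inr ` e) ` edges H\<rparr>"

definition graph_join :: "'u sgraph \<Rightarrow> 'v sgraph \<Rightarrow> ('u + 'v) sgraph" where
  "graph_join G H =
     \<lparr>verts = verts (graph_union G H),
      edges = edges (graph_union G H) \<union> {{Inl u, Inr v} | u v. u \<in> verts G \<and> v \<in> verts H}\<rparr>"

definition delete_edge :: "'v sgraph \<Rightarrow> 'v set \<Rightarrow> 'v sgraph" where
  "delete_edge G e = \<lparr>verts = verts G, edges = edges G - {e}\<rparr>"

definition incident_edges :: "'v sgraph \<Rightarrow> 'v \<Rightarrow> 'v set set" where
  "incident_edges G v = {e \<in> edges G. v \<in> e}"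

text \<open>Matrices are indexed by an initial segment of the naturals, so the rows and columns follow an
  arbitrary enumeration of the vertices. Another enumeration conjugates the matrix by a permutation
  matrix and leaves its spectrum unchanged; see \<open>eigenvalue_adjacency_matrix_iff\<close> below.\<close>

definition vertex_list :: "'v sgraph \<Rightarrow> 'v list" where
  "vertex_list G = (SOME vs. distinct vs \<and> set vs = verts G)"

definition adjacency_matrix :: "'v sgraph \<Rightarrow> real mat" where
  "adjacency_matrix G =
     mat (graph_order G) (graph_order G)
       (\<lambda>(i, j). if {vertex_list G ! i, vertex_list G ! j} \<in> edges G then 1 else 0)"

text \<open>The adjacency matrix is real symmetric, so all its eigenvalues are real and the maximum is
  taken over the whole spectrum.\<close>

definition graph_spectral_radius :: "'v sgraph \<Rightarrow> real" where
  "graph_spectral_radius G = Max (spectrum (adjacency_matrix G))"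

definition fractional_factor :: "nat \<Rightarrow> nat \<Rightarrow> 'v sgraph \<Rightarrow> ('v set \<Rightarrow> real) \<Rightarrow> bool" where
  "fractional_factor a b G h \<longleftrightarrow>
     (\<forall>e\<in>edges G. 0 \<le> h e \<and> h e \<le> 1) \<and>
     (\<forall>v\<in>verts G. real a \<le> (\<Sum>e\<in>incident_edges G v. h e) \<and>
                  (\<Sum>e\<in>incident_edges G v. h e) \<le> real b)"

definition fractional_deleted_graph :: "nat \<Rightarrow> nat \<Rightarrow> 'v sgraph \<Rightarrow> bool" where
  "fractional_deleted_graph a b G \<longleftrightarrow>
     (\<forall>e\<in>edges G. \<exists>h. fractional_factor a b (delete_edge G e) h)"

lemma vertex_list:
  assumes "simple_graph G"
  shows "distinct (vertex_list G)" "set (vertex_list G) = verts G"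
    "length (vertex_list G) = graph_order G"
proof -
  have "\<exists>vs. distinct vs \<and> set vs = verts G"
    using assms finite_distinct_list unfolding simple_graph_def by metis
  then have *: "distinct (vertex_list G) \<and> set (vertex_list G) = verts G"
    unfolding vertex_list_def by (rule someI_ex)
  then show "distinct (vertex_list G)" "set (vertex_list G) = verts G"
    by auto
  from * show "length (vertex_list G) = graph_order G"
    unfolding graph_order_def using distinct_card by metis
qed

lemma eigenvalue_adjacency_matrix_iff:
  assumes G: "simple_graph G"
  shows "eigenvalue (adjacency_matrix G) k \<longleftrightarrow>
    (\<exists>x. (\<exists>v\<in>verts G. x v \<noteq> 0) \<and>
         (\<forall>v\<in>verts G. (\<Sum>u | u \<in> verts G \<and> {v, u} \<in> edges G. x u) = k * x v))"
    (is "?L \<longleftrightarrow> ?R")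
proof -
  define n where "n = graph_order G"
  define vs where "vs = vertex_list G"
  let ?A = "adjacency_matrix G"
  have vs: "distinct vs" "set vs = verts G" "length vs = n"
    using vertex_list[OF G] by (auto simp: vs_def n_def)
  have bij: "bij_betw (\<lambda>i. vs ! i) {0..<n} (verts G)"
    using bij_betw_nth[of vs "{0..<n}" "verts G"] vs by (auto simp: atLeast0LessThan)
  have A: "?A \<in> carrier_mat n n"
    by (simp add: adjacency_matrix_def n_def)
  have fin: "finite (verts G)" using G by (simp add: simple_graph_def)
  have mult: "(?A *\<^sub>v w) $ i = (\<Sum>u | u \<in> verts G \<and> {vs ! i, u} \<in> edges G. x u)"
    if i: "i < n" and w: "w \<in> carrier_vec n" and x: "\<And>j. j < n \<Longrightarrow> w $ j = x (vs ! j)"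
    for i w x
  proof -
    have "(?A *\<^sub>v w) $ i = (\<Sum>j\<in>{0..<n}. (if {vs ! i, vs ! j} \<in> edges G then x (vs ! j) else 0))"
      using i w x A
      by (auto simp: scalar_prod_def adjacency_matrix_def vs_def n_def intro!: sum.cong)
    also have "\<dots> = (\<Sum>u\<in>verts G. (if {vs ! i, u} \<in> edges G then x u else 0))"
      by (rule sum.reindex_bij_betw[OF bij])
    also have "\<dots> = (\<Sum>u | u \<in> verts G \<and> {vs ! i, u} \<in> edges G. x u)"
      using fin by (simp add: sum.If_cases Collect_conj_eq)
    finally show ?thesis .
  qed
  have ex: "\<exists>i<n. v = vs ! i" if "v \<in> verts G" for v
    using that vs by (metis in_set_conv_nth)
  have mem: "vs ! i \<in> verts G" if "i < n" for i
    using that vs nth_mem by metis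
  show ?thesis
  proof
    assume ?L
    then obtain w where w: "w \<in> carrier_vec n" "w \<noteq> 0\<^sub>v n" "?A *\<^sub>v w = k \<cdot>\<^sub>v w"
      using A unfolding eigenvalue_def eigenvector_def by auto
    define x where "x v = w $ (THE i. i < n \<and> vs ! i = v)" for v
    have x: "w $ j = x (vs ! j)" if "j < n" for j
    proof -
      have "(THE i. i < n \<and> vs ! i = vs ! j) = j"
        using that vs by (intro the_equality) (auto simp: nth_eq_iff_index_eq)
      then show ?thesis by (simp add: x_def)
    qed
    from w obtain i where "i < n" "w $ i \<noteq> 0"
      by (metis carrier_vecD eq_vecI index_zero_vec)
    then have "\<exists>v\<in>verts G. x v \<noteq> 0" using x mem by metis
    moreover have "(\<Sum>u | u \<in> verts G \<and> {v, u} \<in> edges G. x u) = k * x v" if v: "v \<in> verts G" for v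
    proof -
      obtain i where i: "i < n" "v = vs ! i" using ex[OF v] by auto
      then show ?thesis using mult[OF i(1) w(1) x] w x[OF i(1)] by simp
    qed
    ultimately show ?R by blast
  next
    assume ?R
    then obtain x where x: "\<exists>v\<in>verts G. x v \<noteq> 0"
      "\<forall>v\<in>verts G. (\<Sum>u | u \<in> verts G \<and> {v, u} \<in> edges G. x u) = k * x v" by blast
    define w where "w = vec n (\<lambda>i. x (vs ! i))"
    have w: "w \<in> carrier_vec n" by (simp add: w_def)
    have wx: "w $ j = x (vs ! j)" if "j < n" for j using that by (simp add: w_def)
    obtain i where "i < n" "w $ i \<noteq> 0" using x(1) ex wx by metis
    then have "w \<noteq> 0\<^sub>v n" by auto
    moreover have "?A *\<^sub>v w = k \<cdot>\<^sub>v w"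
    proof (rule eq_vecI)
      fix i assume "i < dim_vec (k \<cdot>\<^sub>v w)"
      then have i: "i < n" using w by simp
      show "(?A *\<^sub>v w) $ i = (k \<cdot>\<^sub>v w) $ i"
        using mult[OF i w wx] x(2) mem[OF i] wx[OF i] i w by simp
    qed (use A w in auto)
    ultimately show ?L using A w unfolding eigenvalue_def eigenvector_def by auto
  qed
qed

end

theory Submission
  imports Defs "HOL-Analysis.Function_Topology"
begin

text \<open>The graph \<open>K\<^sub>a \<or> (K\<^sub>n\<^sub>-\<^sub>a\<^sub>-\<^sub>1 \<union> K\<^sub>1)\<close> contains every graph of order \<open>n\<close> that has a vertex of degree at most
  \<open>a\<close>, and it contains a clique on \<open>n - 1\<close> vertices. Hence \<open>G\<close> has minimum degree at least \<open>a + 1\<close> and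
  spectral radius greater than \<open>n - 2\<close>. The Hong-Shu-Fang bound, which exploits the minimum degree, then
  shows that at most \<open>n - 2 - a/2\<close> edges are missing from \<open>G\<close>. (Hong's bound alone allows \<open>n - 2\<close> missing
  edges, which is too weak: \<open>K\<^sub>3 \<or> 2K\<^sub>2\<close> with \<open>a = b = 3\<close> is not fractional deleted.) These two facts imply
  \<open>b |S| + (\<Sum>v\<in>T. d\<^sub>G\<^sub>-\<^sub>e\<^sub>-\<^sub>S(v) - a) \<ge> 0\<close> for all disjoint \<open>S\<close> and \<open>T\<close>, which is sufficient for a fractional
  \<open>[a, b]\<close>-factor of \<open>G - e\<close>.\<close>

subsection \<open>Rayleigh quotients of nonnegative kernels\<close>

text \<open>Tychonoff's theorem for the product topology on functions; the index type may be
  infinite. It makes optimal vectors on vertices, and later optimal edge weightings, exist.\<close>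

lemma compact_unit_cube: "compact {x :: 'i \<Rightarrow> real. \<forall>i. x i \<in> {0..1}}"
proof -
  have "{x :: 'i \<Rightarrow> real. \<forall>i. x i \<in> {0..1}} = PiE UNIV (\<lambda>_. {0..1})"
    by auto
  moreover have "compactin (product_topology (\<lambda>_. euclidean) UNIV) (PiE UNIV (\<lambda>_ :: 'i. {0..1::real}))"
    unfolding compactin_PiE by simp
  ultimately show ?thesis
    by (simp add: euclidean_product_topology)
qed

text \<open>First-order optimality condition: near 0 the linear term outweighs the square, and
  \<open>t\<close> may have either sign.\<close>

lemma linear_dominated_by_square_imp_zero:
  fixes c C :: real
  assumes "\<And>t. c * t \<le> C * t\<^sup>2"
  shows "c = 0"
proof (rule ccontr)
  assume "c \<noteq> 0"
  define D where "D = \<bar>C\<bar> + 1"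
  have D: "D > 0" "C < D" by (auto simp: D_def)
  \<comment> \<open>With \<open>t = c / D\<close> the left side is \<open>c\<^sup>2 / D\<close>, and
    \<open>D > C\<close> makes the right side smaller unless \<open>c = 0\<close>.\<close>
  have "c * (c / D) \<le> C * (c / D)\<^sup>2" by (rule assms)
  then have "c\<^sup>2 * D \<le> C * c\<^sup>2"
    using D by (simp add: field_simps power2_eq_square)
  moreover have "C * c\<^sup>2 < D * c\<^sup>2"
    using D \<open>c \<noteq> 0\<close> by simp
  ultimately show False by (simp add: mult.commute)
qed

text \<open>A kernel on a set of vertices stands in for a matrix, so no enumeration of the vertices
  enters the analysis.\<close>

definition quad_form :: "'v set \<Rightarrow> ('v \<Rightarrow> 'v \<Rightarrow> real) \<Rightarrow> ('v \<Rightarrow> real) \<Rightarrow> real" where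
  "quad_form V A x = (\<Sum>v\<in>V. \<Sum>u\<in>V. A v u * x v * x u)"

lemma quad_form_scale: "quad_form V A (\<lambda>v. c * x v) = c\<^sup>2 * quad_form V A x"
  by (simp add: quad_form_def sum_distrib_left power2_eq_square ac_simps)

lemma quad_form_perturb:
  assumes "finite V" "w \<in> V" "\<And>u v. A u v = A v u"
  shows "quad_form V A (\<lambda>v. x v + (if v = w then t else 0)) =
    quad_form V A x + 2 * t * (\<Sum>u\<in>V. A w u * x u) + t\<^sup>2 * A w w"
proof -
  have "quad_form V A (\<lambda>v. x v + (if v = w then t else 0)) =
    (\<Sum>v\<in>V. \<Sum>u\<in>V. A v u * x v * x u + (if u = w then A v w * x v * t else 0)
      + (if v = w then t * (A w u * x u) else 0)
      + (if v = w then (if u = w then t\<^sup>2 * A w w else 0) else 0))"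
    unfolding quad_form_def
    by (intro sum.cong refl) (simp add: algebra_simps power2_eq_square)
  also have "\<dots> = quad_form V A x + (\<Sum>v\<in>V. A v w * x v * t)
      + (\<Sum>u\<in>V. t * (A w u * x u)) + t\<^sup>2 * A w w"
  proof -
    have 1: "(\<Sum>u\<in>V. if v = w then t * (A w u * x u) else 0) =
      (if v = w then (\<Sum>u\<in>V. t * (A w u * x u)) else 0)" for v by simp
    have 2: "(\<Sum>u\<in>V. if v = w then (if u = w then t\<^sup>2 * A w w else 0) else 0) =
      (if v = w then t\<^sup>2 * A w w else 0)" for v using assms by simp
    show ?thesis using assms(1,2)
      by (simp only: sum.distrib quad_form_def 1 2) simp
  qed
  also have "(\<Sum>v\<in>V. A v w * x v * t) = t * (\<Sum>u\<in>V. A w u * x u)"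
    unfolding sum_distrib_left by (intro sum.cong refl) (simp add: assms(3)[of _ w] ac_simps)
  finally show ?thesis by (simp flip: sum_distrib_left)
qed

text \<open>For a nonnegative kernel, passing to absolute values does not decrease the quadratic form,
  so maximising it over nonnegative unit vectors gives the global Rayleigh maximum.\<close>

lemma nonneg_symmetric_kernel_max_eigenvector:
  fixes A :: "'v \<Rightarrow> 'v \<Rightarrow> real"
  assumes fin: "finite V" and ne: "V \<noteq> {}"
    and sym: "\<And>u v. A u v = A v u" and nonneg: "\<And>u v. A u v \<ge> 0"
  obtains \<mu> x where "\<And>v. 0 \<le> x v" "\<exists>v\<in>V. x v \<noteq> 0"
    "\<And>v. v \<in> V \<Longrightarrow> (\<Sum>u\<in>V. A v u * x u) = \<mu> * x v"
    "\<And>z. quad_form V A z \<le> \<mu> * (\<Sum>v\<in>V. (z v)\<^sup>2)"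
proof -
  \<comment> \<open>A nonnegative unit vector has its coordinates on \<open>V\<close> in [0, 1]
    anyway. Bounding the coordinates outside \<open>V\<close> as well gives compactness in the full
    function space.\<close>
  define K where "K = {x :: 'v \<Rightarrow> real. \<forall>v. x v \<in> {0..1}} \<inter> {x. (\<Sum>v\<in>V. (x v)\<^sup>2) = 1}"
  have "closed {x :: 'v \<Rightarrow> real. (\<Sum>v\<in>V. (x v)\<^sup>2) = 1}"
    by (intro closed_Collect_eq continuous_intros continuous_on_product_coordinates)
  then have "compact K"
    unfolding K_def by (intro compact_Int_closed compact_unit_cube)
  moreover obtain w where w: "w \<in> V" using ne by blast
  have "(\<Sum>v\<in>V. (if v = w then 1 else 0 :: real)\<^sup>2) = (\<Sum>v\<in>V. if v = w then 1 else 0)"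
    by (intro sum.cong) auto
  then have "(\<lambda>v. if v = w then 1 else 0) \<in> K"
    using w fin by (simp add: K_def)
  then have "K \<noteq> {}" by blast
  moreover have "continuous_on K (quad_form V A)"
    unfolding quad_form_def
    by (intro continuous_intros continuous_on_subset[OF continuous_on_product_coordinates]) auto
  ultimately obtain x where x: "x \<in> K" "\<And>z. z \<in> K \<Longrightarrow> quad_form V A z \<le> quad_form V A x"
    using continuous_attains_sup by metis
  define \<mu> where "\<mu> = quad_form V A x"
  have bound: "quad_form V A z \<le> \<mu> * (\<Sum>v\<in>V. (z v)\<^sup>2)" for z
  proof (cases "\<exists>v\<in>V. z v \<noteq> 0")
    case False
    then show ?thesis by (simp add: quad_form_def)
  next
    case True
    define s where "s = (\<Sum>v\<in>V. (z v)\<^sup>2)"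
    have s: "s > 0"
      unfolding s_def using True fin
      by (metis (no_types, lifting) sum_pos2 zero_le_power2 zero_less_power2)
    \<comment> \<open>The value 0 outside \<open>V\<close> puts the normalised vector into
      \<open>K\<close>, which constrains every coordinate.\<close>
    define z' where "z' v = (if v \<in> V then \<bar>z v\<bar> / sqrt s else 0)" for v
    have zs: "(z v)\<^sup>2 \<le> s" if "v \<in> V" for v
      unfolding s_def using fin that by (intro member_le_sum) auto
    have "\<bar>z v\<bar> \<le> sqrt s" if "v \<in> V" for v
      using zs[OF that] real_le_rsqrt by (metis power2_abs)
    then have "z' v \<in> {0..1}" for v
      using s by (auto simp: z'_def)
    moreover have "(\<Sum>v\<in>V. (z' v)\<^sup>2) = (\<Sum>v\<in>V. (z v)\<^sup>2) / s"
      unfolding sum_divide_distrib using s by (intro sum.cong) (auto simp: z'_def power_divide)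
    ultimately have "z' \<in> K" using s by (simp add: K_def s_def)
    then have le: "quad_form V A z' \<le> \<mu>" using x(2) by (simp add: \<mu>_def)
    have "quad_form V A z \<le> quad_form V A (\<lambda>v. \<bar>z v\<bar>)"
      unfolding quad_form_def
    proof (intro sum_mono)
      fix v u
      have "A v u * (z v * z u) \<le> A v u * (\<bar>z v\<bar> * \<bar>z u\<bar>)"
        using nonneg by (intro mult_left_mono) (auto simp flip: abs_mult)
      then show "A v u * z v * z u \<le> A v u * \<bar>z v\<bar> * \<bar>z u\<bar>" by (simp add: mult.assoc)
    qed
    also have "\<dots> = quad_form V A (\<lambda>v. sqrt s * z' v)"
      unfolding quad_form_def using s by (intro sum.cong refl) (simp add: z'_def)
    also have "\<dots> = s * quad_form V A z'"
      using s by (simp add: quad_form_scale)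
    also have "\<dots> \<le> s * \<mu>" using le s by simp
    finally show ?thesis by (simp add: s_def mult.commute)
  qed
  have unit: "(\<Sum>v\<in>V. (x v)\<^sup>2) = 1" using x(1) by (simp add: K_def)
  show ?thesis
  proof (rule that[of x \<mu>])
    show "0 \<le> x v" for v using x(1) by (simp add: K_def)
    show "\<exists>v\<in>V. x v \<noteq> 0"
    proof (rule ccontr)
      assume "\<not> ?thesis"
      then have "(\<Sum>v\<in>V. (x v)\<^sup>2) = 0" by simp
      then show False using unit by simp
    qed
    show "(\<Sum>u\<in>V. A w u * x u) = \<mu> * x w" if w: "w \<in> V" for w
    proof -
      \<comment> \<open>The Rayleigh inequality is an equality at \<open>x\<close>, so the linear
        term under a change of coordinate \<open>w\<close> must vanish. The changed vector may leave
        \<open>K\<close>, hence the use of the global \<open>bound\<close>.\<close>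
      let ?c = "2 * ((\<Sum>u\<in>V. A w u * x u) - \<mu> * x w)"
      have "?c * t \<le> (\<mu> - A w w) * t\<^sup>2" for t
      proof -
        have "(\<Sum>v\<in>V. (x v + (if v = w then t else 0))\<^sup>2) =
            (\<Sum>v\<in>V. (x v)\<^sup>2 + (if v = w then 2 * t * x w + t\<^sup>2 else 0))"
          by (intro sum.cong refl) (simp add: power2_sum)
        also have "\<dots> = 1 + 2 * t * x w + t\<^sup>2"
          using w fin unit by (simp add: sum.distrib)
        finally show ?thesis
          using bound[of "\<lambda>v. x v + (if v = w then t else 0)"] quad_form_perturb[of V w A x t, OF fin w sym]
          by (simp add: \<mu>_def algebra_simps)
      qed
      then have "?c = 0" by (rule linear_dominated_by_square_imp_zero)
      then show ?thesis by simp
    qed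
    show "quad_form V A z \<le> \<mu> * (\<Sum>v\<in>V. (z v)\<^sup>2)" for z by (rule bound)
  qed
qed

subsection \<open>Bounds on the spectral radius of a graph\<close>

definition neighbors :: "'v sgraph \<Rightarrow> 'v \<Rightarrow> 'v set" where
  "neighbors G v = {u \<in> verts G. {v, u} \<in> edges G}"

abbreviation vertex_degree :: "'v sgraph \<Rightarrow> 'v \<Rightarrow> nat" where
  "vertex_degree G v \<equiv> card (neighbors G v)"

lemma finite_neighbors: "simple_graph G \<Longrightarrow> finite (neighbors G v)"
  by (simp add: neighbors_def simple_graph_def)

lemma neighbors_subset: "neighbors G v \<subseteq> verts G"
  by (auto simp: neighbors_def)

lemma not_in_own_neighbors: "simple_graph G \<Longrightarrow> v \<notin> neighbors G v"
  by (auto simp: neighbors_def simple_graph_def)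

text \<open>Both sides run over all ordered pairs of adjacent vertices; adjacency is symmetric,
  while \<open>f\<close> need not be.\<close>

lemma sum_neighbors_swap:
  assumes "simple_graph G"
  shows "(\<Sum>v\<in>verts G. \<Sum>u\<in>neighbors G v. f v u) = (\<Sum>u\<in>verts G. \<Sum>v\<in>neighbors G u. f v u)"
proof -
  have fin: "finite (verts G)" using assms by (simp add: simple_graph_def)
  show ?thesis
    unfolding neighbors_def using fin
    by (subst sum.swap_restrict) (auto simp: insert_commute)
qed

text \<open>The quadratic form of the adjacency matrix; each edge counts twice.\<close>

definition edge_form :: "'v sgraph \<Rightarrow> ('v \<Rightarrow> real) \<Rightarrow> real" where
  "edge_form G x = (\<Sum>v\<in>verts G. \<Sum>u\<in>neighbors G v. x v * x u)"

text \<open>Bridge from the matrix spectrum to sums over neighbors: the Rayleigh maximum is itself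
  an eigenvalue, and every eigenvalue is the Rayleigh quotient of its eigenvector.\<close>

lemma graph_spectral_radius_variational:
  assumes G: "simple_graph G" and ne: "verts G \<noteq> {}"
  obtains x where "\<And>v. 0 \<le> x v" "\<exists>v\<in>verts G. x v \<noteq> 0"
    "\<And>v. v \<in> verts G \<Longrightarrow> (\<Sum>u\<in>neighbors G v. x u) = graph_spectral_radius G * x v"
    "\<And>z. edge_form G z \<le> graph_spectral_radius G * (\<Sum>v\<in>verts G. (z v)\<^sup>2)"
proof -
  define A where "A u v = (if {u, v} \<in> edges G then 1 else 0 :: real)" for u v
  have fin: "finite (verts G)" using G by (simp add: simple_graph_def)
  have A_sum: "(\<Sum>u\<in>verts G. A v u * f u) = (\<Sum>u\<in>neighbors G v. f u)" for v f
    using fin by (simp add: A_def neighbors_def sum.inter_filter if_distrib[of "\<lambda>c. c * _"] cong: if_cong)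
  have form: "quad_form (verts G) A z = edge_form G z" for z
  proof -
    have "(\<Sum>u\<in>verts G. A v u * z v * z u) = (\<Sum>u\<in>neighbors G v. z v * z u)" for v
      using A_sum[of v "\<lambda>u. z v * z u"] by (simp add: mult.assoc)
    then show ?thesis by (simp add: quad_form_def edge_form_def)
  qed
  have A: "A u v = A v u" "A u v \<ge> 0" for u v
    by (auto simp: A_def insert_commute)
  obtain \<mu> x where x: "\<And>v. 0 \<le> x v" "\<exists>v\<in>verts G. x v \<noteq> 0"
    "\<And>v. v \<in> verts G \<Longrightarrow> (\<Sum>u\<in>neighbors G v. x u) = \<mu> * x v"
    "\<And>z. edge_form G z \<le> \<mu> * (\<Sum>v\<in>verts G. (z v)\<^sup>2)"
    using nonneg_symmetric_kernel_max_eigenvector[of "verts G" A, OF fin ne A]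
    unfolding form A_sum by metis
  let ?M = "adjacency_matrix G"
  note ev = eigenvalue_adjacency_matrix_iff[OF G, folded neighbors_def]
  have "?M \<in> carrier_mat (graph_order G) (graph_order G)"
    by (simp add: adjacency_matrix_def)
  then have "finite (spectrum ?M)" by (rule card_finite_spectrum)
  moreover have "\<mu> \<in> spectrum ?M"
    using x(2,3) by (auto simp: spectrum_def ev)
  moreover have "k \<le> \<mu>" if k: "k \<in> spectrum ?M" for k
  proof -
    obtain z where z: "\<exists>v\<in>verts G. z v \<noteq> 0" "\<forall>v\<in>verts G. (\<Sum>u\<in>neighbors G v. z u) = k * z v"
      using k[unfolded spectrum_def mem_Collect_eq ev] by blast
    have "edge_form G z = (\<Sum>v\<in>verts G. z v * (k * z v))"
      unfolding edge_form_def using z(2) by (intro sum.cong) (simp_all flip: sum_distrib_left)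
    also have "\<dots> = k * (\<Sum>v\<in>verts G. (z v)\<^sup>2)"
      by (simp add: sum_distrib_left power2_eq_square ac_simps)
    finally have "k * (\<Sum>v\<in>verts G. (z v)\<^sup>2) \<le> \<mu> * (\<Sum>v\<in>verts G. (z v)\<^sup>2)"
      using x(4)[of z] by simp
    moreover have "(\<Sum>v\<in>verts G. (z v)\<^sup>2) > 0"
      using z(1) fin by (metis (no_types, lifting) sum_pos2 zero_le_power2 zero_less_power2)
    ultimately show ?thesis by simp
  qed
  ultimately have "graph_spectral_radius G = \<mu>"
    unfolding graph_spectral_radius_def by (intro Max_eqI)
  then show ?thesis using that x by blast
qed

text \<open>The nonnegative eigenvector of \<open>G\<close>, transported along \<open>f\<close>, is
  a test vector for \<open>H\<close>; further edges of \<open>H\<close> only add nonnegative terms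
  to the form.\<close>

lemma graph_spectral_radius_mono:
  assumes G: "simple_graph G" "verts G \<noteq> {}" and H: "simple_graph H"
    and bij: "bij_betw f (verts G) (verts H)"
    and edges: "\<And>u v. u \<in> verts G \<Longrightarrow> v \<in> verts G \<Longrightarrow> {u, v} \<in> edges G \<Longrightarrow> {f u, f v} \<in> edges H"
  shows "graph_spectral_radius G \<le> graph_spectral_radius H"
proof -
  obtain x where x: "\<And>v. 0 \<le> x v" "\<exists>v\<in>verts G. x v \<noteq> 0"
    "\<And>v. v \<in> verts G \<Longrightarrow> (\<Sum>u\<in>neighbors G v. x u) = graph_spectral_radius G * x v"
    using graph_spectral_radius_variational[OF G] by metis
  have neH: "verts H \<noteq> {}" using bij G(2) by (auto simp: bij_betw_def)
  define z where "z = x \<circ> inv_into (verts G) f"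
  have zf: "z (f v) = x v" if "v \<in> verts G" for v
    using bij that by (simp add: z_def bij_betw_def)
  have inj: "inj_on f (verts G)" using bij by (simp add: bij_betw_def)
  have sq: "(\<Sum>w\<in>verts H. (z w)\<^sup>2) = (\<Sum>v\<in>verts G. (x v)\<^sup>2)"
    by (subst sum.reindex_bij_betw[OF bij, symmetric]) (simp add: zf)
  have z0: "z w \<ge> 0" for w using x(1) by (simp add: z_def)
  have finG: "finite (verts G)" using G by (simp add: simple_graph_def)
  have "graph_spectral_radius G * (\<Sum>v\<in>verts G. (x v)\<^sup>2) = edge_form G x"
    unfolding edge_form_def sum_distrib_left
    by (intro sum.cong refl) (simp add: x(3) power2_eq_square flip: sum_distrib_left)
  also have "\<dots> \<le> (\<Sum>v\<in>verts G. \<Sum>w\<in>neighbors H (f v). x v * z w)"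
    unfolding edge_form_def
  proof (rule sum_mono)
    fix v assume v: "v \<in> verts G"
    have "(\<Sum>u\<in>neighbors G v. x v * x u) = (\<Sum>u\<in>neighbors G v. x v * z (f u))"
      by (intro sum.cong refl) (auto simp: zf neighbors_def)
    also have "\<dots> = (\<Sum>w\<in>f ` neighbors G v. x v * z w)"
      using inj_on_subset[OF inj neighbors_subset] by (subst sum.reindex) auto
    also have "\<dots> \<le> (\<Sum>w\<in>neighbors H (f v). x v * z w)"
    proof (rule sum_mono2)
      show "f ` neighbors G v \<subseteq> neighbors H (f v)"
        using edges[OF v] bij by (auto simp: neighbors_def bij_betw_def)
    qed (use H x(1) z0 finite_neighbors in auto)
    finally show "(\<Sum>u\<in>neighbors G v. x v * x u) \<le> (\<Sum>w\<in>neighbors H (f v). x v * z w)" .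
  qed
  also have "\<dots> = (\<Sum>v\<in>verts G. \<Sum>w\<in>neighbors H (f v). z (f v) * z w)"
    by (intro sum.cong refl) (simp add: zf)
  also have "\<dots> = edge_form H z"
    unfolding edge_form_def by (rule sum.reindex_bij_betw[OF bij])
  also have "\<dots> \<le> graph_spectral_radius H * (\<Sum>w\<in>verts H. (z w)\<^sup>2)"
    using graph_spectral_radius_variational[OF H neH] by metis
  finally have "graph_spectral_radius G * (\<Sum>v\<in>verts G. (x v)\<^sup>2) \<le>
      graph_spectral_radius H * (\<Sum>v\<in>verts G. (x v)\<^sup>2)" by (simp add: sq)
  moreover have "(\<Sum>v\<in>verts G. (x v)\<^sup>2) > 0"
    using x(2) finG by (metis (no_types, lifting) sum_pos2 zero_le_power2 zero_less_power2)
  ultimately show ?thesis by simp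
qed

text \<open>The indicator function of \<open>C\<close> has Rayleigh quotient at least
  \<open>card C - 1\<close>.\<close>

lemma graph_spectral_radius_ge_clique:
  assumes G: "simple_graph G" and C: "C \<subseteq> verts G" "C \<noteq> {}"
    and clique: "\<And>u v. u \<in> C \<Longrightarrow> v \<in> C \<Longrightarrow> u \<noteq> v \<Longrightarrow> {u, v} \<in> edges G"
  shows "real (card C) - 1 \<le> graph_spectral_radius G"
proof -
  have fin: "finite (verts G)" using G by (simp add: simple_graph_def)
  then have finC: "finite C" using C finite_subset by blast
  define z where "z v = (if v \<in> C then 1 else 0 :: real)" for v
  have "real (card C) * (real (card C) - 1) = (\<Sum>v\<in>C. \<Sum>u\<in>C - {v}. 1)"
    using finC C(2) by (simp add: of_nat_diff Suc_le_eq card_gt_0_iff)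
  also have "\<dots> = (\<Sum>v\<in>C. \<Sum>u\<in>C - {v}. z v * z u)"
    by (intro sum.cong refl) (auto simp: z_def)
  also have "\<dots> \<le> (\<Sum>v\<in>C. \<Sum>u\<in>neighbors G v. z v * z u)"
    using C clique finite_neighbors[OF G]
    by (intro sum_mono sum_mono2) (auto simp: z_def neighbors_def)
  also have "\<dots> \<le> edge_form G z"
    unfolding edge_form_def using C fin by (intro sum_mono2) (auto simp: z_def intro!: sum_nonneg)
  also have "\<dots> \<le> graph_spectral_radius G * (\<Sum>v\<in>verts G. (z v)\<^sup>2)"
    using graph_spectral_radius_variational[OF G] C by (metis subset_empty)
  also have "(\<Sum>v\<in>verts G. (z v)\<^sup>2) = (\<Sum>v\<in>C. (z v)\<^sup>2)"
    using fin C by (intro sum.mono_neutral_right) (auto simp: z_def)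
  also have "\<dots> = real (card C)" by (simp add: z_def)
  finally have "real (card C) * (real (card C) - 1) \<le> real (card C) * graph_spectral_radius G"
    by (simp add: mult.commute)
  then show ?thesis using finC C(2) by (simp add: card_gt_0_iff)
qed

text \<open>The bound of Hong, Shu and Fang: the column sums of \<open>A\<^sup>2 - k A\<close> are at most the right-hand
  side, and a nonnegative eigenvector turns column sums into eigenvalue bounds.\<close>

lemma graph_spectral_radius_degree_bound:
  fixes k :: nat
  assumes G: "simple_graph G" and ne: "verts G \<noteq> {}"
    and deg: "\<And>v. v \<in> verts G \<Longrightarrow> k + 1 \<le> vertex_degree G v"
  shows "(graph_spectral_radius G)\<^sup>2 - k * graph_spectral_radius G \<le>
    (\<Sum>v\<in>verts G. real (vertex_degree G v)) - (real (graph_order G) - 1) * (k + 1)"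
proof -
  define n where "n = graph_order G"
  define \<rho> where "\<rho> = graph_spectral_radius G"
  define D where "D = (\<Sum>v\<in>verts G. real (vertex_degree G v))"
  have fin: "finite (verts G)" using G by (simp add: simple_graph_def)
  obtain x where x: "\<And>v. 0 \<le> x v" "\<exists>v\<in>verts G. x v \<noteq> 0"
    "\<And>v. v \<in> verts G \<Longrightarrow> (\<Sum>u\<in>neighbors G v. x u) = \<rho> * x v"
    using graph_spectral_radius_variational[OF G ne] unfolding \<rho>_def by metis
  define X where "X = (\<Sum>v\<in>verts G. x v)"
  have X: "X > 0"
    unfolding X_def using x(1,2) fin by (metis order_le_less sum_pos2)
  \<comment> \<open>\<open>one\<close> and \<open>two\<close> pair the column sums of the adjacency
    matrix and of its square with the eigenvector.\<close>
  have one: "(\<Sum>v\<in>verts G. vertex_degree G v * x v) = \<rho> * X"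
  proof -
    have "(\<Sum>v\<in>verts G. vertex_degree G v * x v) = (\<Sum>v\<in>verts G. \<Sum>u\<in>neighbors G v. x v)" by simp
    also have "\<dots> = (\<Sum>u\<in>verts G. \<Sum>v\<in>neighbors G u. x v)" by (rule sum_neighbors_swap[OF G])
    also have "\<dots> = \<rho> * X" unfolding X_def sum_distrib_left by (simp add: x(3))
    finally show ?thesis .
  qed
  have two: "(\<Sum>v\<in>verts G. (\<Sum>u\<in>neighbors G v. real (vertex_degree G u)) * x v) = \<rho>\<^sup>2 * X"
  proof -
    have "(\<Sum>v\<in>verts G. (\<Sum>u\<in>neighbors G v. real (vertex_degree G u)) * x v) =
        (\<Sum>v\<in>verts G. \<Sum>u\<in>neighbors G v. vertex_degree G u * x v)"
      by (simp add: sum_distrib_right)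
    also have "\<dots> = (\<Sum>u\<in>verts G. \<Sum>v\<in>neighbors G u. vertex_degree G u * x v)"
      by (rule sum_neighbors_swap[OF G])
    also have "\<dots> = (\<Sum>u\<in>verts G. \<rho> * (vertex_degree G u * x u))"
      by (intro sum.cong refl) (simp add: x(3) flip: sum_distrib_left)
    also have "\<dots> = \<rho>\<^sup>2 * X" using one by (simp add: power2_eq_square flip: sum_distrib_left)
    finally show ?thesis .
  qed
  \<comment> \<open>Each of the \<open>n - 1 - d(v)\<close> vertices outside the closed neighborhood
    of \<open>v\<close> has degree at least \<open>k + 1\<close>. Subtracting \<open>k d(v)\<close>
    is exactly what cancels \<open>d(v)\<close> from the resulting bound.\<close>
  have col: "(\<Sum>u\<in>neighbors G v. real (vertex_degree G u)) - k * real (vertex_degree G v) \<le> D - (real n - 1) * (k + 1)"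
    if v: "v \<in> verts G" for v
  proof -
    let ?N = "insert v (neighbors G v)"
    have sub: "?N \<subseteq> verts G" using v neighbors_subset[of G v] by auto
    have "real (card (verts G - ?N)) * (k + 1) \<le> (\<Sum>u\<in>verts G - ?N. real (vertex_degree G u))"
    proof -
      have "real (k + 1) \<le> real (vertex_degree G u)" if "u \<in> verts G - ?N" for u
        using deg[of u] that by (subst of_nat_le_iff) simp
      then show ?thesis by (rule sum_bounded_below)
    qed
    also have "\<dots> = D - (\<Sum>u\<in>?N. real (vertex_degree G u))"
      unfolding D_def using fin sub by (rule sum_diff)
    also have "(\<Sum>u\<in>?N. real (vertex_degree G u)) = vertex_degree G v + (\<Sum>u\<in>neighbors G v. real (vertex_degree G u))"
      using finite_neighbors[OF G] not_in_own_neighbors[OF G] by simp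
    also have "real (card (verts G - ?N)) = real n - 1 - vertex_degree G v"
    proof -
      have cN: "card ?N = vertex_degree G v + 1"
        using finite_neighbors[OF G] not_in_own_neighbors[OF G] by simp
      have "card ?N \<le> n" unfolding n_def graph_order_def using sub fin by (rule card_mono[rotated])
      moreover have "card (verts G - ?N) = n - card ?N"
        unfolding n_def graph_order_def using sub fin finite_subset by (intro card_Diff_subset) auto
      ultimately show ?thesis using cN by (simp add: of_nat_diff)
    qed
    finally show ?thesis by (simp add: algebra_simps)
  qed
  have "(\<rho>\<^sup>2 - k * \<rho>) * X =
      (\<Sum>v\<in>verts G. ((\<Sum>u\<in>neighbors G v. real (vertex_degree G u)) - k * real (vertex_degree G v)) * x v)"
    using one two by (simp add: left_diff_distrib sum_subtractf mult.assoc flip: sum_distrib_left)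
  also have "\<dots> \<le> (\<Sum>v\<in>verts G. (D - (real n - 1) * (k + 1)) * x v)"
    by (intro sum_mono mult_right_mono col x(1))
  also have "\<dots> = (D - (real n - 1) * (k + 1)) * X"
    by (simp add: X_def sum_distrib_left)
  finally show ?thesis using X by (simp add: \<rho>_def D_def n_def)
qed

subsection \<open>Existence of fractional factors\<close>

lemma sum_incident_edges:
  assumes G: "simple_graph G" and v: "v \<in> verts G"
  shows "(\<Sum>e\<in>incident_edges G v. h e) = (\<Sum>u\<in>neighbors G v. h {v, u})"
proof -
  have "bij_betw (\<lambda>u. {v, u}) (neighbors G v) (incident_edges G v)"
    unfolding bij_betw_def
  proof
    show "inj_on (\<lambda>u. {v, u}) (neighbors G v)"
      by (auto simp: inj_on_def doubleton_eq_iff)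
    show "(\<lambda>u. {v, u}) ` neighbors G v = incident_edges G v"
    proof (intro equalityI subsetI)
      fix e assume "e \<in> incident_edges G v"
      then have e: "e \<in> edges G" "v \<in> e" by (auto simp: incident_edges_def)
      then have "card e = 2" "e \<subseteq> verts G" using G by (auto simp: simple_graph_def)
      then obtain u where "e = {v, u}" using e(2) by (auto simp: card_2_iff)
      then show "e \<in> (\<lambda>u. {v, u}) ` neighbors G v"
        using e \<open>e \<subseteq> verts G\<close> by (auto simp: neighbors_def)
    qed (auto simp: neighbors_def incident_edges_def)
  qed
  then show ?thesis by (rule sum.reindex_bij_betw[symmetric])
qed

definition clamp_to :: "real \<Rightarrow> real \<Rightarrow> real \<Rightarrow> real" where
  "clamp_to a b x = max a (min b x)"

text \<open>Allows the target value to stay frozen while the weights move: this can only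
  overestimate the new distance to the interval.\<close>

lemma clamp_to_nearest:
  assumes "a \<le> b" "a \<le> q" "q \<le> b"
  shows "(x - clamp_to a b x)\<^sup>2 \<le> (x - q)\<^sup>2"
  using assms by (intro power2_le_iff_abs_le[THEN iffD2] abs_le_square_iff[THEN iffD1])
    (auto simp: clamp_to_def)

definition edge_weight_sum :: "'v sgraph \<Rightarrow> ('v set \<Rightarrow> real) \<Rightarrow> 'v \<Rightarrow> real" where
  "edge_weight_sum G h v = (\<Sum>u\<in>neighbors G v. h {v, u})"

lemma edge_weight_sum_update:
  assumes G: "simple_graph G" and e: "{p, q} \<in> edges G" and v: "v \<in> verts G"
  shows "edge_weight_sum G (h({p, q} := h {p, q} + t)) v =
    edge_weight_sum G h v + (if v \<in> {p, q} then t else 0)"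
proof -
  have pq: "p \<noteq> q" "p \<in> verts G" "q \<in> verts G"
    using G e by (auto simp: simple_graph_def card_insert_if)
  have "edge_weight_sum G (h({p, q} := h {p, q} + t)) v =
      (\<Sum>u\<in>neighbors G v. h {v, u} + (if {v, u} = {p, q} then t else 0))"
    unfolding edge_weight_sum_def by (intro sum.cong) auto
  also have "\<dots> = edge_weight_sum G h v + (\<Sum>u\<in>neighbors G v. if {v, u} = {p, q} then t else 0)"
    by (simp add: sum.distrib edge_weight_sum_def)
  also have "(\<Sum>u\<in>neighbors G v. if {v, u} = {p, q} then t else 0) = (if v \<in> {p, q} then t else 0)"
  proof -
    have "(\<Sum>u\<in>neighbors G v. if {v, u} = {p, q} then t else 0) = (\<Sum>u\<in>neighbors G v. if u = r then t else 0)"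
      if "v = p \<and> r = q \<or> v = q \<and> r = p" for r
      using that pq by (intro sum.cong) (auto simp: doubleton_eq_iff)
    moreover have "r \<in> neighbors G v" if "v = p \<and> r = q \<or> v = q \<and> r = p" for r
      using that e pq by (auto simp: neighbors_def insert_commute)
    moreover have "(\<Sum>u\<in>neighbors G v. if {v, u} = {p, q} then t else 0) = 0" if "v \<notin> {p, q}"
      using that by (intro sum.neutral) (auto simp: doubleton_eq_iff)
    ultimately show ?thesis
      using finite_neighbors[OF G, of v] by (cases "v = p"; cases "v = q") auto
  qed
  finally show ?thesis .
qed

text \<open>Choose \<open>h\<close> with least total squared distance of the weight sums to \<open>[a, b]\<close>, and let \<open>y v\<close> be the
  signed distance at \<open>v\<close>. Minimality forces \<open>h = 0\<close> on edges with \<open>y p + y q > 0\<close> and \<open>h = 1\<close> on edges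
  with \<open>y p + y q < 0\<close>. If the largest value \<open>\<theta>\<close> of \<open>\<bar>y\<bar>\<close> were positive, then counting the weight
  between \<open>S = {y = \<theta>}\<close> and \<open>T = {y = -\<theta>}\<close> from both sides would violate the hypothesis.\<close>

lemma fractional_factor_exists:
  fixes a b :: nat
  assumes G: "simple_graph G" and ab: "a \<le> b"
    and cond: "\<And>S T. S \<subseteq> verts G \<Longrightarrow> T \<subseteq> verts G \<Longrightarrow> S \<inter> T = {} \<Longrightarrow>
      0 \<le> real b * card S + (\<Sum>v\<in>T. real (card (neighbors G v - S)) - real a)"
  shows "\<exists>h. fractional_factor a b G h"
proof -
  have fin: "finite (verts G)" using G by (simp add: simple_graph_def)
  note finN = finite_neighbors[OF G]
  let ?d = "edge_weight_sum G" and ?c = "clamp_to (real a) (real b)"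
  define \<Phi> where "\<Phi> h = (\<Sum>v\<in>verts G. (?d h v - ?c (?d h v))\<^sup>2)" for h
  define K where "K = {h :: 'a set \<Rightarrow> real. \<forall>e. h e \<in> {0..1}}"
  have "continuous_on K \<Phi>"
    unfolding \<Phi>_def edge_weight_sum_def clamp_to_def
    by (intro continuous_intros continuous_on_subset[OF continuous_on_product_coordinates]) auto
  moreover have "(\<lambda>_. 0) \<in> K" by (simp add: K_def)
  then have "K \<noteq> {}" by blast
  moreover have "compact K" unfolding K_def by (rule compact_unit_cube)
  ultimately obtain h where h: "h \<in> K" "\<And>g. g \<in> K \<Longrightarrow> \<Phi> h \<le> \<Phi> g"
    using continuous_attains_inf[of K \<Phi>] by blast
  have h01: "0 \<le> h e" "h e \<le> 1" for e using h(1) by (auto simp: K_def)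
  define y where "y v = ?d h v - ?c (?d h v)" for v
  \<comment> \<open>Moving one edge weight by \<open>t\<close> changes the sums at its two ends
    only. With frozen targets the objective grows by at most
    \<open>2 t (y p + y q) + 2 t\<^sup>2\<close>, which minimality makes nonnegative.\<close>
  have step: "0 \<le> t * (y p + y q) + t\<^sup>2"
    if e: "{p, q} \<in> edges G" and t: "0 \<le> h {p, q} + t" "h {p, q} + t \<le> 1" for p q t
  proof -
    have pq: "p \<noteq> q" "p \<in> verts G" "q \<in> verts G"
      using G e by (auto simp: simple_graph_def card_insert_if)
    let ?g = "h({p, q} := h {p, q} + t)"
    have "?g \<in> K" using h01 t by (simp add: K_def)
    then have "\<Phi> h \<le> \<Phi> ?g" by (rule h(2))
    also have "\<dots> \<le> (\<Sum>v\<in>verts G. (?d ?g v - ?c (?d h v))\<^sup>2)"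
      unfolding \<Phi>_def using ab
      by (intro sum_mono clamp_to_nearest) (auto simp: clamp_to_def)
    also have "\<dots> = (\<Sum>v\<in>verts G. (y v)\<^sup>2 + (if v = p then 2 * t * y p + t\<^sup>2 else 0)
        + (if v = q then 2 * t * y q + t\<^sup>2 else 0))"
    proof (rule sum.cong[OF refl])
      fix v assume "v \<in> verts G"
      then have "?d ?g v - ?c (?d h v) = y v + (if v \<in> {p, q} then t else 0)"
        using edge_weight_sum_update[OF G e, of v h t] by (simp add: y_def)
      then show "(?d ?g v - ?c (?d h v))\<^sup>2 = (y v)\<^sup>2 + (if v = p then 2 * t * y p + t\<^sup>2 else 0)
          + (if v = q then 2 * t * y q + t\<^sup>2 else 0)"
        using pq(1) by (cases "v = p"; cases "v = q") (simp_all add: power2_sum)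
    qed
    also have "\<dots> = \<Phi> h + 2 * t * y p + t\<^sup>2 + 2 * t * y q + t\<^sup>2"
      using fin pq by (simp add: sum.distrib \<Phi>_def y_def)
    finally show ?thesis by (simp add: algebra_simps)
  qed
  have zero: "h {p, q} = 0" if e: "{p, q} \<in> edges G" and pos: "y p + y q > 0" for p q
  proof (rule ccontr)
    assume "h {p, q} \<noteq> 0"
    then have hp: "h {p, q} > 0" using h01[of "{p, q}"] by simp
    \<comment> \<open>The first bound keeps the lowered weight nonnegative, the second lets the
      linear gain beat \<open>t\<^sup>2\<close>.\<close>
    define t where "t = min (h {p, q}) ((y p + y q) / 2)"
    have t: "0 < t" "t \<le> h {p, q}" "t < y p + y q" using hp pos by (auto simp: t_def min_def)
    have "0 \<le> t * (t - (y p + y q))"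
      using step[OF e, of "- t"] t h01[of "{p, q}"] by (simp add: power2_eq_square algebra_simps)
    then show False using t by (simp add: zero_le_mult_iff)
  qed
  have one: "h {p, q} = 1" if e: "{p, q} \<in> edges G" and neg: "y p + y q < 0" for p q
  proof (rule ccontr)
    assume "h {p, q} \<noteq> 1"
    then have hp: "h {p, q} < 1" using h01[of "{p, q}"] by simp
    define t where "t = min (1 - h {p, q}) (- (y p + y q) / 2)"
    have t: "0 < t" "t \<le> 1 - h {p, q}" "t < - (y p + y q)" using hp neg by (auto simp: t_def min_def)
    have "0 \<le> t * (t + (y p + y q))"
      using step[OF e, of t] t h01[of "{p, q}"] by (simp add: power2_eq_square algebra_simps)
    then show False using t by (simp add: zero_le_mult_iff)
  qed
  have y0: "y v = 0" if v: "v \<in> verts G" for v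
  proof (rule ccontr)
    assume "y v \<noteq> 0"
    define \<theta> where "\<theta> = Max ((\<lambda>v. \<bar>y v\<bar>) ` verts G)"
    have \<theta>: "\<bar>y u\<bar> \<le> \<theta>" if "u \<in> verts G" for u
      unfolding \<theta>_def using fin that by (intro Max_ge) auto
    have pos: "\<theta> > 0" using \<theta>[OF v] \<open>y v \<noteq> 0\<close> by simp
    define S where "S = {u \<in> verts G. y u = \<theta>}"
    define T where "T = {u \<in> verts G. y u = - \<theta>}"
    have ST: "S \<subseteq> verts G" "T \<subseteq> verts G" "S \<inter> T = {}" "finite S" "finite T"
      using pos fin by (auto simp: S_def T_def)
    have "\<theta> \<in> (\<lambda>v. \<bar>y v\<bar>) ` verts G"
      unfolding \<theta>_def using fin v by (intro Max_in) auto
    then obtain u where "u \<in> verts G" "\<bar>y u\<bar> = \<theta>" by auto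
    then have "u \<in> S \<union> T" by (auto simp: S_def T_def)
    then have "card S + card T > 0" using ST by (auto simp: card_gt_0_iff)
    have dS: "?d h u = real b + \<theta>" if "u \<in> S" for u
      using that pos ab by (auto simp: S_def y_def clamp_to_def max_def min_def split: if_splits)
    have dT: "?d h u = real a - \<theta>" if "u \<in> T" for u
      using that pos ab by (auto simp: T_def y_def clamp_to_def max_def min_def split: if_splits)
    \<comment> \<open>A neighbor \<open>w\<close> outside \<open>T\<close> has
      \<open>y w > - \<theta>\<close>, so its edge to \<open>u\<close> carries weight 0: all weight
      at \<open>S\<close> goes to \<open>T\<close>.\<close>
    have sS: "?d h u = (\<Sum>w\<in>neighbors G u \<inter> T. h {u, w})" if u: "u \<in> S" for u
      unfolding edge_weight_sum_def
    proof (rule sum.mono_neutral_right)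
      show "\<forall>w\<in>neighbors G u - neighbors G u \<inter> T. h {u, w} = 0"
      proof
        fix w assume w: "w \<in> neighbors G u - neighbors G u \<inter> T"
        then have "w \<in> verts G" "y w \<noteq> - \<theta>" by (auto simp: neighbors_def T_def)
        then have "y u + y w > 0" using \<theta>[of w] u by (auto simp: S_def)
        then show "h {u, w} = 0" using w by (intro zero) (auto simp: neighbors_def)
      qed
    qed (use finN in auto)
    \<comment> \<open>Dually, every edge from \<open>T\<close> to a vertex outside \<open>S\<close>
      is saturated.\<close>
    have sT: "?d h u = (\<Sum>w\<in>neighbors G u \<inter> S. h {u, w}) + real (card (neighbors G u - S))"
      if u: "u \<in> T" for u
    proof -
      have "(\<Sum>w\<in>neighbors G u - S. h {u, w}) = (\<Sum>w\<in>neighbors G u - S. 1)"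
      proof (rule sum.cong[OF refl])
        fix w assume w: "w \<in> neighbors G u - S"
        then have "w \<in> verts G" "y w \<noteq> \<theta>" by (auto simp: neighbors_def S_def)
        then have "y u + y w < 0" using \<theta>[of w] u by (auto simp: T_def)
        then show "h {u, w} = 1" using w by (intro one) (auto simp: neighbors_def)
      qed
      then show ?thesis
        unfolding edge_weight_sum_def using sum.Int_Diff[OF finN, of "\<lambda>w. h {u, w}" u S] by simp
    qed
    have cross: "(\<Sum>u\<in>S. \<Sum>w\<in>neighbors G u \<inter> T. h {u, w}) = (\<Sum>u\<in>T. \<Sum>w\<in>neighbors G u \<inter> S. h {u, w})"
    proof -
      have "neighbors G u \<inter> T = {w \<in> T. {u, w} \<in> edges G}" "neighbors G u \<inter> S = {w \<in> S. {w, u} \<in> edges G}" for u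
        using ST by (auto simp: neighbors_def insert_commute)
      then show ?thesis
        using sum.swap_restrict[OF ST(4,5), of "\<lambda>u w. h {u, w}" "\<lambda>u w. {u, w} \<in> edges G"]
        by (simp add: insert_commute)
    qed
    \<comment> \<open>The weight between \<open>S\<close> and \<open>T\<close>, evaluated from both
      sides, turns the expression in \<open>cond\<close> into
      \<open>- \<theta> (card S + card T)\<close>, which is negative.\<close>
    have "real (card S) * (real b + \<theta>) = (\<Sum>u\<in>S. ?d h u)" by (simp add: dS)
    also have "\<dots> = (\<Sum>u\<in>T. \<Sum>w\<in>neighbors G u \<inter> S. h {u, w})" using cross by (simp add: sS)
    also have "\<dots> = (\<Sum>u\<in>T. ?d h u) - (\<Sum>u\<in>T. real (card (neighbors G u - S)))"
      by (simp add: sT sum.distrib)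
    also have "(\<Sum>u\<in>T. ?d h u) = real (card T) * (real a - \<theta>)" by (simp add: dT)
    finally have "real b * card S + (\<Sum>v\<in>T. real (card (neighbors G v - S)) - real a) =
        - \<theta> * (card S + card T)"
      by (simp add: sum_subtractf algebra_simps)
    then have "0 \<le> - \<theta> * (real (card S + card T))"
      using cond[OF ST(1-3)] by simp
    moreover have "0 < \<theta> * (real (card S + card T))"
      using pos \<open>card S + card T > 0\<close> by (intro mult_pos_pos) linarith+
    ultimately show False by simp
  qed
  have "fractional_factor a b G h"
    unfolding fractional_factor_def
  proof (intro conjI ballI)
    fix v assume v: "v \<in> verts G"
    have "?d h v = ?c (?d h v)" using y0[OF v] by (simp add: y_def)
    then have "real a \<le> ?d h v" "?d h v \<le> real b"
      using ab by (auto simp: clamp_to_def max_def min_def split: if_splits)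
    then show "real a \<le> (\<Sum>e\<in>incident_edges G v. h e)" "(\<Sum>e\<in>incident_edges G v. h e) \<le> real b"
      using sum_incident_edges[OF G v, of h] by (simp_all add: edge_weight_sum_def)
  qed (use h01 in auto)
  then show ?thesis by blast
qed

subsection \<open>The extremal graph and the theorem\<close>

lemma simple_graph_complete: "simple_graph (complete_graph m)"
  by (auto simp: simple_graph_def complete_graph_def)

lemma simple_graph_union:
  assumes "simple_graph G" "simple_graph H"
  shows "simple_graph (graph_union G H)"
  using assms by (auto simp: simple_graph_def graph_union_def card_image)

lemma simple_graph_join:
  assumes "simple_graph G" "simple_graph H"
  shows "simple_graph (graph_join G H)"
proof -
  have "edges (graph_join G H) = edges (graph_union G H) \<union> {{Inl u, Inr v} |u v. u \<in> verts G \<and> v \<in> verts H}"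
    "verts (graph_join G H) = verts (graph_union G H)" "verts (graph_union G H) = verts G <+> verts H"
    by (simp_all add: graph_join_def graph_union_def)
  then show ?thesis
    using simple_graph_union[OF assms] by (auto simp: simple_graph_def)
qed

lemma edge_complete_graph: "{i, j} \<in> edges (complete_graph m) \<longleftrightarrow> i < m \<and> j < m \<and> i \<noteq> j"
  by (auto simp: complete_graph_def card_insert_if)

lemma edge_graph_unionI:
  shows "{u, v} \<in> edges G \<Longrightarrow> {Inl u, Inl v} \<in> edges (graph_union G H)"
    and "{u', v'} \<in> edges H \<Longrightarrow> {Inr u', Inr v'} \<in> edges (graph_union G H)"
proof -
  show "{Inl u, Inl v} \<in> edges (graph_union G H)" if "{u, v} \<in> edges G"
    using that unfolding graph_union_def by simp (intro disjI1 image_eqI[of _ _ "{u, v}"], auto)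
  show "{Inr u', Inr v'} \<in> edges (graph_union G H)" if "{u', v'} \<in> edges H"
    using that unfolding graph_union_def by simp (intro disjI2 image_eqI[of _ _ "{u', v'}"], auto)
qed

text \<open>The last rule repeats the third with the ends exchanged, so that either order of a cross
  edge matches during introduction.\<close>

lemma edge_graph_joinI:
  shows "{u, v} \<in> edges G \<Longrightarrow> {Inl u, Inl v} \<in> edges (graph_join G H)"
    and "{u', v'} \<in> edges H \<Longrightarrow> {Inr u', Inr v'} \<in> edges (graph_join G H)"
    and "u \<in> verts G \<Longrightarrow> v' \<in> verts H \<Longrightarrow> {Inl u, Inr v'} \<in> edges (graph_join G H)"
    and "u \<in> verts G \<Longrightarrow> v' \<in> verts H \<Longrightarrow> {Inr v', Inl u} \<in> edges (graph_join G H)"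
proof -
  show "{Inl u, Inl v} \<in> edges (graph_join G H)" if "{u, v} \<in> edges G"
    using edge_graph_unionI(1)[OF that, of H] by (simp add: graph_join_def)
  show "{Inr u', Inr v'} \<in> edges (graph_join G H)" if "{u', v'} \<in> edges H"
    using edge_graph_unionI(2)[OF that, of G] by (simp add: graph_join_def)
  show "{Inl u, Inr v'} \<in> edges (graph_join G H)" if "u \<in> verts G" "v' \<in> verts H"
    using that by (auto simp: graph_join_def)
  then show "{Inr v', Inl u} \<in> edges (graph_join G H)" if "u \<in> verts G" "v' \<in> verts H"
    using that by (simp add: insert_commute)
qed

text \<open>The extremal graph, with \<open>m\<close> for \<open>n - a - 1\<close>. Its special
  vertex \<open>Inr (Inr 0)\<close> is adjacent to the \<open>Inl\<close> vertices alone and has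
  degree \<open>a\<close>.\<close>

definition clique_plus_vertex :: "nat \<Rightarrow> nat \<Rightarrow> (nat + nat + nat) sgraph" where
  "clique_plus_vertex a m =
     graph_join (complete_graph a) (graph_union (complete_graph m) (complete_graph 1))"

lemma simple_graph_clique_plus_vertex: "simple_graph (clique_plus_vertex a m)"
  unfolding clique_plus_vertex_def
  by (intro simple_graph_join simple_graph_union simple_graph_complete)

lemma verts_clique_plus_vertex:
  "verts (clique_plus_vertex a m) = {..<a} <+> ({..<m} <+> {0})"
  by (auto simp: clique_plus_vertex_def graph_join_def graph_union_def complete_graph_def)

lemma edge_clique_plus_vertexI:
  assumes "x \<in> verts (clique_plus_vertex a m)" "y \<in> verts (clique_plus_vertex a m)" "x \<noteq> y"
    and "x = Inr (Inr 0) \<Longrightarrow> y \<in> range Inl" "y = Inr (Inr 0) \<Longrightarrow> x \<in> range Inl"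
  shows "{x, y} \<in> edges (clique_plus_vertex a m)"
proof -
  have vC: "verts (complete_graph k) = {..<k}" for k by (simp add: complete_graph_def)
  have vU: "verts (graph_union G H) = verts G <+> verts H" for G :: "'u sgraph" and H :: "'w sgraph"
    by (simp add: graph_union_def)
  show ?thesis
    using assms unfolding verts_clique_plus_vertex
    by (auto simp: clique_plus_vertex_def edge_complete_graph vC vU
        intro!: edge_graph_joinI edge_graph_unionI)
qed

text \<open>Without the special vertex the graph is a clique on \<open>a + m\<close> vertices; the
  empty summand in \<open>?C\<close> removes that vertex.\<close>

lemma graph_spectral_radius_clique_plus_vertex_ge:
  assumes "a > 0"
  shows "real (a + m) - 1 \<le> graph_spectral_radius (clique_plus_vertex a m)"
proof -
  let ?H = "clique_plus_vertex a m"
  let ?C = "{..<a} <+> ({..<m} <+> {}) :: (nat + nat + nat) set"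
  have "real (card ?C) - 1 \<le> graph_spectral_radius ?H"
  proof (rule graph_spectral_radius_ge_clique[OF simple_graph_clique_plus_vertex])
    show "?C \<subseteq> verts ?H" unfolding verts_clique_plus_vertex by auto
    show "?C \<noteq> {}" using assms by auto
    show "{u, v} \<in> edges ?H" if "u \<in> ?C" "v \<in> ?C" "u \<noteq> v" for u v
      using that by (intro edge_clique_plus_vertexI) (auto simp: verts_clique_plus_vertex)
  qed
  then show ?thesis by (simp add: card_Plus)
qed

text \<open>\<open>G\<close> embeds with \<open>v\<close> as the special vertex, since the only
  pairs missing from the extremal graph join that vertex to the \<open>m\<close>-clique.\<close>

lemma graph_spectral_radius_le_clique_plus_vertex:
  assumes G: "simple_graph G" and v: "v \<in> verts G"
    and deg: "vertex_degree G v \<le> a" and order: "graph_order G = a + m + 1"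
  shows "graph_spectral_radius G \<le> graph_spectral_radius (clique_plus_vertex a m)"
proof -
  let ?H = "clique_plus_vertex a m"
  have fin: "finite (verts G)" using G by (simp add: simple_graph_def)
  have card: "card (verts G - {v}) = a + m" using order v fin by (simp add: graph_order_def)
  have "neighbors G v \<subseteq> verts G - {v}"
    using neighbors_subset[of G v] not_in_own_neighbors[OF G] by blast
  \<comment> \<open>The neighborhood is padded to exactly \<open>a\<close> vertices, to be mapped
    onto the \<open>a\<close>-clique; the remaining \<open>m\<close> vertices fill the other
    one.\<close>
  then obtain A where A: "neighbors G v \<subseteq> A" "A \<subseteq> verts G - {v}" "card A = a"
    using exists_subset_between[OF deg _ _ finite_Diff[OF fin], of "{v}"] card by auto
  define B where "B = verts G - {v} - A"
  have finAB: "finite A" "finite B" using A(2) fin finite_subset by (auto simp: B_def)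
  have "card B = m"
    unfolding B_def using card A finAB by (simp add: card_Diff_subset)
  obtain f where f: "bij_betw f A {..<a}"
    using ex_bij_betw_finite_nat[OF finAB(1)] A(3) by (auto simp: atLeast0LessThan)
  obtain g where g: "bij_betw g B {..<m}"
    using ex_bij_betw_finite_nat[OF finAB(2)] \<open>card B = m\<close> by (auto simp: atLeast0LessThan)
  define \<phi> :: "'a \<Rightarrow> nat + nat + nat" where
    "\<phi> u = (if u = v then Inr (Inr 0) else if u \<in> A then Inl (f u) else Inr (Inl (g u)))" for u
  have V: "verts G = A \<union> (B \<union> {v})" "v \<notin> A" "v \<notin> B" "A \<inter> B = {}" using A v by (auto simp: B_def)
  have inj: "inj_on \<phi> (verts G)"
  proof (rule inj_onI)
    fix p q assume "p \<in> verts G" "q \<in> verts G" "\<phi> p = \<phi> q"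
    then show "p = q"
      using V inj_onD[OF bij_betw_imp_inj_on[OF f], of p q] inj_onD[OF bij_betw_imp_inj_on[OF g], of p q]
      by (simp add: \<phi>_def split: if_splits)
  qed
  have "\<phi> ` A = Inl ` f ` A"
    unfolding image_image using V(2) by (intro image_cong) (auto simp: \<phi>_def)
  moreover have "\<phi> ` B = Inr ` Inl ` g ` B"
    unfolding image_image using V(3,4) by (intro image_cong) (auto simp: \<phi>_def)
  moreover have "\<phi> v = Inr (Inr 0)" by (simp add: \<phi>_def)
  ultimately have "\<phi> ` A = Inl ` {..<a}" "\<phi> ` B = Inr ` Inl ` {..<m}" "\<phi> v = Inr (Inr 0)"
    using f g by (simp_all add: bij_betw_def)
  then have img: "\<phi> ` verts G = verts ?H"
    unfolding V(1) image_Un verts_clique_plus_vertex by auto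
  show ?thesis
  proof (rule graph_spectral_radius_mono[OF G _ simple_graph_clique_plus_vertex])
    show "verts G \<noteq> {}" using v by blast
    show "bij_betw \<phi> (verts G) (verts ?H)" using inj img by (simp add: bij_betw_def)
    fix p q assume pq: "p \<in> verts G" "q \<in> verts G" "{p, q} \<in> edges G"
    then have "p \<noteq> q" using G by (auto simp: simple_graph_def)
    show "{\<phi> p, \<phi> q} \<in> edges ?H"
    proof (rule edge_clique_plus_vertexI)
      show "\<phi> p \<in> verts ?H" "\<phi> q \<in> verts ?H" using pq img by auto
      show "\<phi> p \<noteq> \<phi> q" using inj pq \<open>p \<noteq> q\<close> by (auto dest: inj_onD)
      have "q \<in> A" if "p = v" using that A(1) pq by (auto simp: neighbors_def)
      then show "\<phi> q \<in> range Inl" if "\<phi> p = Inr (Inr 0)"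
        using that V by (auto simp: \<phi>_def split: if_splits)
      have "p \<in> A" if "q = v" using that A(1) pq by (auto simp: neighbors_def insert_commute)
      then show "\<phi> p \<in> range Inl" if "\<phi> q = Inr (Inr 0)"
        using that V by (auto simp: \<phi>_def split: if_splits)
    qed
  qed
qed

section \<open>Edge deletion and the degree count\<close>

lemma simple_graph_delete_edge: "simple_graph G \<Longrightarrow> simple_graph (delete_edge G e)"
  by (simp add: simple_graph_def delete_edge_def)

lemma vertex_degree_delete_edge:
  assumes G: "simple_graph G" and e: "e \<in> edges G"
  shows "real (vertex_degree (delete_edge G e) v) = real (vertex_degree G v) - (if v \<in> e then 1 else 0)"
proof (cases "v \<in> e")
  case True
  have "card e = 2" "e \<subseteq> verts G" using G e by (auto simp: simple_graph_def)
  then obtain u where u: "e = {v, u}" using True by (auto simp: card_2_iff)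
  then have un: "u \<in> neighbors G v" using e \<open>e \<subseteq> verts G\<close> by (auto simp: neighbors_def)
  have "neighbors (delete_edge G e) v = neighbors G v - {u}"
    by (auto simp: neighbors_def delete_edge_def u doubleton_eq_iff)
  moreover have "vertex_degree G v > 0" using un finite_neighbors[OF G] by (auto simp: card_gt_0_iff)
  ultimately show ?thesis using un True finite_neighbors[OF G] by (simp add: of_nat_diff)
next
  case False
  then have "neighbors (delete_edge G e) v = neighbors G v"
    by (auto simp: neighbors_def delete_edge_def)
  then show ?thesis using False by simp
qed

text \<open>Settles the case of large \<open>T\<close>. In terms of the number \<open>r\<close> of
  vertices outside \<open>S\<close> and \<open>T\<close>, the only summand that can be negative is
  \<open>(t - 1) * (t - 2 - a)\<close>. Integers make its failure a single boundary case.\<close>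

lemma factor_condition_arith:
  fixes a b n s t :: int
  assumes ab: "a \<le> b" "3 \<le> b" and n: "s + t \<le> n" "7 \<le> n" and s: "2 \<le> s" and t: "b + 1 \<le> t"
  shows "0 \<le> b * s + t * (n - 1 - s - a) - (2 * n - 2 - a)"
proof -
  define r where "r = n - s - t"
  have r: "r \<ge> 0" "n = s + t + r" using n by (auto simp: r_def)
  have eq: "b * s + t * (n - 1 - s - a) - (2 * n - 2 - a) =
      (b - 2) * s + (t - 1) * (t - 2 - a) + r * (t - 2)"
    unfolding r(2) by (simp add: algebra_simps)
  have rt: "0 \<le> r * (t - 2)" using r ab t by simp
  show ?thesis
  proof (cases "a \<le> t - 2")
    case True
    have "0 \<le> (b - 2) * s" "0 \<le> (t - 1) * (t - 2 - a)" using ab s t True by auto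
    then show ?thesis using eq rt by linarith
  next
    case False
    \<comment> \<open>\<open>a > t - 2\<close> together with \<open>a \<le> b \<le> t - 1\<close>
      leaves only equality.\<close>
    then have at: "a = t - 1" "b = t - 1" using ab t by auto
    have eq': "(b - 2) * s + (t - 1) * (t - 2 - a) + r * (t - 2) = (t - 3) * s + r * (t - 2) - (t - 1)"
      unfolding at by (simp add: algebra_simps)
    show ?thesis
    \<comment> \<open>For \<open>t = 4\<close> the value is \<open>s + 2 r - 3\<close>, and
      \<open>n \<ge> 7\<close> gives \<open>s + r \<ge> 3\<close>. For \<open>t \<ge> 5\<close> the
      bound \<open>s \<ge> 2\<close> is enough.\<close>
    proof (cases "t = 4")
      case True
      then show ?thesis using eq eq' r n s by simp
    next
      case False
      then have "5 \<le> t" using at ab by auto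
      then have "0 \<le> (t - 3) * (s - 2)" using s by simp
      moreover have "(t - 3) * s + r * (t - 2) - (t - 1) = (t - 3) * (s - 2) + r * (t - 2) + (t - 5)"
        by (simp add: algebra_simps)
      ultimately show ?thesis unfolding eq eq' using rt \<open>5 \<le> t\<close> by (simp only: add_nonneg_nonneg diff_ge_0_iff_ge)
    qed
  qed
qed

text \<open>Only degree information about \<open>G\<close> is needed: \<open>card (neighbors G v - S)\<close> is at least the degree
  minus \<open>card S\<close>. For small \<open>T\<close> the minimum degree suffices, for large \<open>T\<close> the degree sum does.\<close>

lemma fractional_deleted_graph_if_degrees:
  fixes a b n :: nat
  assumes G: "simple_graph G" and n: "graph_order G = n" "7 \<le> n" and ab: "a \<le> b" "3 \<le> b"
    and deg: "\<And>v. v \<in> verts G \<Longrightarrow> a + 1 \<le> vertex_degree G v"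
    and total: "real n * (real n - 1) - (\<Sum>v\<in>verts G. real (vertex_degree G v)) \<le> 2 * real n - 4 - real a"
  shows "fractional_deleted_graph a b G"
  unfolding fractional_deleted_graph_def
proof
  fix e assume e: "e \<in> edges G"
  let ?G = "delete_edge G e"
  have G': "simple_graph ?G" using G by (rule simple_graph_delete_edge)
  have V: "verts ?G = verts G" by (simp add: delete_edge_def)
  have fin: "finite (verts G)" using G by (simp add: simple_graph_def)
  have ce: "card e = 2" "e \<subseteq> verts G" using G e by (auto simp: simple_graph_def)
  then have fe: "finite e" using fin finite_subset by blast
  note degG' = vertex_degree_delete_edge[OF G e]
  have sum_e: "(\<Sum>v\<in>T. if v \<in> e then 1 else 0 :: real) = real (card (T \<inter> e))" if "finite T" for T
    using that by (simp add: sum.If_cases)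
  show "\<exists>h. fractional_factor a b ?G h"
  proof (rule fractional_factor_exists[OF G' ab(1)])
    fix S T assume ST: "S \<subseteq> verts ?G" "T \<subseteq> verts ?G" "S \<inter> T = {}"
    then have ST': "S \<subseteq> verts G" "T \<subseteq> verts G" by (simp_all add: V)
    have finST: "finite S" "finite T" using ST' fin finite_subset by auto
    define s t where "s = card S" and "t = card T"
    have st: "s + t \<le> n"
      unfolding s_def t_def n(1)[symmetric] graph_order_def
      using card_mono[OF fin, of "S \<union> T"] ST' card_Un_disjoint[OF finST ST(3)] by simp
    let ?d = "\<lambda>v. real (vertex_degree ?G v)"
    have "?d v - real s \<le> real (card (neighbors ?G v - S))" for v
      using diff_card_le_card_Diff[OF finST(1), of "neighbors ?G v"] by (simp add: s_def)
    then have lower: "(\<Sum>v\<in>T. ?d v - real s - real a) \<le> (\<Sum>v\<in>T. real (card (neighbors ?G v - S)) - real a)"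
      by (intro sum_mono) simp
    have low_deg: "real a + 1 - (if v \<in> e then 1 else 0) \<le> ?d v" if "v \<in> T" for v
      using deg[of v] that ST' by (simp add: degG' subset_iff)
    have "0 \<le> real b * real s + (\<Sum>v\<in>T. real (card (neighbors ?G v - S)) - real a)"
    proof (cases "s = 0")
      case True
      have "0 \<le> (\<Sum>v\<in>T. ?d v - real s - real a)"
        using low_deg True by (intro sum_nonneg) (fastforce split: if_splits)
      then show ?thesis using lower True by simp
    next
      case False
      show ?thesis
      \<comment> \<open>Each vertex of \<open>T\<close> contributes at least \<open>1 - s\<close>,
        less 1 if it is an end of \<open>e\<close>. The total loss is at most
        \<open>t (s - 1) + 2\<close>, which \<open>b s\<close> covers here.\<close>
      proof (cases "t \<le> b \<or> s = 1")
        case True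
        have "(\<Sum>v\<in>T. 1 - real s - (if v \<in> e then 1 else 0)) \<le> (\<Sum>v\<in>T. ?d v - real s - real a)"
          using low_deg by (intro sum_mono) fastforce
        moreover have "(\<Sum>v\<in>T. 1 - real s - (if v \<in> e then 1 else 0)) = real t * (1 - real s) - real (card (T \<inter> e))"
          using finST by (simp add: sum_subtractf sum_e t_def algebra_simps)
        moreover have "card (T \<inter> e) \<le> 2" using ce fe card_mono[of e "T \<inter> e"] by simp
        moreover have "real t * (real s - 1) + 2 \<le> real b * real s"
        proof (cases "s = 1")
          case True
          then show ?thesis using ab by simp
        next
          case False
          then have "real t * (real s - 1) \<le> real b * (real s - 1)"
            using True \<open>s \<noteq> 0\<close> by (intro mult_right_mono) auto
          then show ?thesis using ab by (simp add: algebra_simps)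
        qed
        ultimately show ?thesis using lower by (simp add: algebra_simps)
      next
        case large: False
        \<comment> \<open>Missing degrees are nonnegative, so \<open>T\<close> misses no more than
          the whole graph does; deleting \<open>e\<close> adds 2 to that total.\<close>
        have "(\<Sum>v\<in>T. real n - 1 - ?d v) \<le> (\<Sum>v\<in>verts G. real n - 1 - ?d v)"
        proof (rule sum_mono2[OF fin ST'(2)])
          fix v
          have "neighbors ?G v \<subseteq> verts G - {v}" if "v \<in> verts G"
            using neighbors_subset[of ?G v] not_in_own_neighbors[OF G'] V by blast
          moreover assume "v \<in> verts G - T"
          ultimately have "vertex_degree ?G v \<le> card (verts G - {v})"
            using fin by (intro card_mono) auto
          also have "\<dots> = n - 1" using \<open>v \<in> verts G - T\<close> fin n by (simp add: graph_order_def)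
          finally show "0 \<le> real n - 1 - ?d v" using n by linarith
        qed
        also have "\<dots> = real n * (real n - 1) - (\<Sum>v\<in>verts G. real (vertex_degree G v)) + 2"
          using sum_e[OF fin] ce n(1) by (simp add: sum_subtractf degG' graph_order_def Int_absorb1)
        also have "\<dots> \<le> 2 * real n - 2 - real a" using total by simp
        finally have "real t * (real n - 1 - real s - real a) - (2 * real n - 2 - real a) \<le>
            (\<Sum>v\<in>T. ?d v - real s - real a)"
          by (simp add: sum_subtractf t_def algebra_simps)
        moreover have "0 \<le> real b * real s + real t * (real n - 1 - real s - real a) - (2 * real n - 2 - real a)"
        proof -
          have "0 \<le> int b * int s + int t * (int n - 1 - int s - int a) - (2 * int n - 2 - int a)"
            using large \<open>s \<noteq> 0\<close> ab n st by (intro factor_condition_arith) auto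
          then have "0 \<le> real_of_int (int b * int s + int t * (int n - 1 - int s - int a) - (2 * int n - 2 - int a))"
            by (simp only: of_int_0_le_iff)
          then show ?thesis by simp
        qed
        ultimately show ?thesis using lower by simp
      qed
    qed
    then show "0 \<le> real b * real (card S) + (\<Sum>v\<in>T. real (card (neighbors ?G v - S)) - real a)"
      by (simp add: s_def)
  qed
qed

theorem theorem1p4:
  fixes a b n :: nat and G :: "'v sgraph"
  assumes "a > 0" and "b > 0" and "b \<ge> max a 3"
    and "simple_graph G" and "graph_order G = n" and "n \<ge> max (a + 2) 7"
    and "graph_spectral_radius G >
         graph_spectral_radius
           (graph_join (complete_graph a)
              (graph_union (complete_graph (n - a - 1)) (complete_graph 1)))"
  shows "fractional_deleted_graph a b G"
proof -
  define \<rho> where "\<rho> = graph_spectral_radius G"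
  have n: "a + 2 \<le> n" "7 \<le> n" using assms(6) by auto
  have \<rho>: "graph_spectral_radius (clique_plus_vertex a (n - a - 1)) < \<rho>"
    using assms(7) by (simp add: \<rho>_def clique_plus_vertex_def)
  have deg: "a + 1 \<le> vertex_degree G v" if "v \<in> verts G" for v
  proof (rule ccontr)
    assume "\<not> ?thesis"
    then have "\<rho> \<le> graph_spectral_radius (clique_plus_vertex a (n - a - 1))"
      unfolding \<rho>_def using n assms(5)
      by (intro graph_spectral_radius_le_clique_plus_vertex[OF assms(4) that]) auto
    then show False using \<rho> by simp
  qed
  have ge: "real n - 2 < \<rho>"
    using graph_spectral_radius_clique_plus_vertex_ge[OF assms(1), of "n - a - 1"] \<rho> n
    by (simp add: of_nat_diff)
  have "verts G \<noteq> {}" using assms(5) n by (auto simp: graph_order_def)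
  have an: "real a + 2 \<le> real n" using n by linarith
  \<comment> \<open>Both factors are nonnegative and increase with \<open>\<rho>\<close>; the right
    side is what the degree bound with \<open>k = a\<close> controls.\<close>
  have "(real n - 2) * (real n - 2 - real a) < \<rho> * (\<rho> - real a)"
    using ge an n by (intro mult_strict_mono') auto
  also have "\<dots> = \<rho>\<^sup>2 - a * \<rho>" by (simp add: power2_eq_square algebra_simps)
  also have "\<dots> \<le> (\<Sum>v\<in>verts G. real (vertex_degree G v)) - (real n - 1) * (a + 1)"
    using graph_spectral_radius_degree_bound[OF assms(4) \<open>verts G \<noteq> {}\<close> deg] assms(5)
    by (simp add: \<rho>_def)
  \<comment> \<open>The passage to integers sharpens the strict bound \<open>2 n - 3 - a\<close> to
    \<open>2 n - 4 - a\<close>.\<close>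
  finally have "real_of_int (int n * (int n - 1) - (\<Sum>v\<in>verts G. int (vertex_degree G v))) < real_of_int (2 * int n - 3 - int a)"
    by (simp add: algebra_simps)
  then have "real_of_int (int n * (int n - 1) - (\<Sum>v\<in>verts G. int (vertex_degree G v))) \<le> real_of_int (2 * int n - 4 - int a)"
    unfolding of_int_less_iff of_int_le_iff by simp
  then show ?thesis
    using assms(3-5) n deg by (intro fractional_deleted_graph_if_degrees) auto
qed

end
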